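(* For each integer $p\ge2$, let $\Omega_p,\Lambda_p$ be finite sets with nonnegative, dimension-independent weights $w_\omega$ ($\omega\in\Omega_p$) and $v_\lambda$ ($\lambda\in\Lambda_p$) and defects $\delta(\omega),j(\lambda)\in\mathbb N_0$. Define $$F_\Omega(p,N)=\sum_{\omega\in\Omega_p}w_\omega N^{-\delta(\omega)},\qquad F_\Lambda(p,M)=\sum_{\lambda\in\Lambda_p}v_\lambda M^{-j(\lambda)}.$$ Suppose that, for a fixed $\kappa\ge0$ and numbers $r_p\ge1$, a map $\phi_p:\Omega_p\to\Lambda_p$ satisfies $$j(\phi_p(\omega))\le\kappa\,\delta(\omega)\quad\text{for every }\omega\in\Omega_p,$$ $$\sum_{\substack{\omega:\ \phi_p(\omega)=\lambda\\ \delta(\omega)=\delta}}w_\omega\le r_p^{\delta}\,v_\lambda\quad\text{for every }\lambda\in\Lambda_p\text{ and every }\delta\in\mathbb N_0.$$ Then, for $M\ge1$ and $N>r_pM^\kappa$, $$F_\Omega(p,N)\le\frac{F_\Lambda(p,M)}{1-r_pM^\kappa/N}.$$ Also, for $M\ge 1$ and $\delta\in\mathbb N_0$, the quantity $a_{p,\delta}:=\sum_{\omega:\ \delta(\omega)=\delta}w_\omega$ satisfies $$a_{p,\delta}\le r_p^\delta M^{\kappa\delta}F_\Lambda(p,M).$$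
   Context: $\mathbb N_0=\{0,1,2,\dots\}$. "Dimension-independent" means that the weights and defects do not depend on $N$ or $M$. *)

theory Defs
  imports Complex_Main
begin

text \<open>
  A family of finite sets indexed by \<open>p\<close> is a function \<open>nat \<Rightarrow> 'a set\<close>; weights and
  defects depend on \<open>p\<close> and on the element, but not on the dimension \<open>x\<close> (which plays
  the role of both \<open>N\<close> and \<open>M\<close>).
\<close>

definition defect_expansion ::
  "(nat \<Rightarrow> 'a set) \<Rightarrow> (nat \<Rightarrow> 'a \<Rightarrow> real) \<Rightarrow> (nat \<Rightarrow> 'a \<Rightarrow> nat) \<Rightarrow> nat \<Rightarrow> real \<Rightarrow> real"
  where "defect_expansion S w d p x = (\<Sum>s\<in>S p. w p s * x powi (- int (d p s)))"

definition defect_coeff ::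
  "(nat \<Rightarrow> 'a set) \<Rightarrow> (nat \<Rightarrow> 'a \<Rightarrow> real) \<Rightarrow> (nat \<Rightarrow> 'a \<Rightarrow> nat) \<Rightarrow> nat \<Rightarrow> nat \<Rightarrow> real"
  where "defect_coeff S w d p k = (\<Sum>s\<in>{s \<in> S p. d p s = k}. w p s)"

end

theory Submission
  imports Defs
begin

text \<open>
  The coefficient bound implies the bound on the whole expansion, and it is proved one fibre of
  \<open>\<phi>\<close> at a time. If some element of defect \<open>d\<close> lies over \<open>\<lambda>\<close>, then \<open>j(\<lambda>) \<le> \<kappa> d\<close>, and for
  \<open>M \<ge> 1\<close> the factor \<open>M\<^bsup>\<kappa>d\<^esup>\<close> outweighs the factor \<open>M\<^bsup>-j(\<lambda>)\<^esup>\<close>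
  that \<open>\<lambda>\<close> carries in the target expansion. Hence the part of the \<open>d\<close>-th coefficient lying over
  \<open>\<lambda>\<close>, which is at most \<open>r\<^sup>d v\<^sub>\<lambda>\<close>, costs at most \<open>r\<^sup>d M\<^bsup>\<kappa>d\<^esup>\<close> times
  the term of \<open>\<lambda>\<close>. The empty fibres contribute nothing, while their terms in the target are
  nonnegative, so summation over all \<open>\<lambda>\<close> gives \<open>defect_coeff_le_of_map\<close>.

  Multiplied by \<open>N\<^bsup>-d\<^esup>\<close>, this says that the defect-\<open>d\<close> part of the source expansion is at most
  \<open>q\<^sup>d\<close> times the target expansion, where \<open>q = r M\<^bsup>\<kappa>\<^esup> / N\<close>. The condition on \<open>N\<close> makes
  \<open>0 \<le> q < 1\<close>, so the sum over \<open>d\<close> is dominated by a geometric series.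
\<close>

lemma defect_expansion_eq_sum_defect_coeff:
  assumes "finite (S p)"
  shows "defect_expansion S w d p x = (\<Sum>k\<in>d p ` S p. defect_coeff S w d p k / x ^ k)"
proof -
  have "defect_expansion S w d p x
      = (\<Sum>k\<in>d p ` S p. \<Sum>s\<in>{s \<in> S p. d p s = k}. w p s * x powi (- int (d p s)))"
    unfolding defect_expansion_def using assms by (intro sum.group[symmetric]) auto
  also have "\<dots> = (\<Sum>k\<in>d p ` S p. defect_coeff S w d p k / x ^ k)"
    unfolding defect_coeff_def
    by (intro sum.cong refl)
      (simp add: sum_distrib_right power_int_minus divide_inverse)
  finally show ?thesis .
qed

lemma defect_expansion_nonneg:
  assumes "\<And>s. s \<in> S p \<Longrightarrow> w p s \<ge> 0" and "x \<ge> 0"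
  shows "defect_expansion S w d p x \<ge> 0"
  unfolding defect_expansion_def using assms by (intro sum_nonneg mult_nonneg_nonneg) auto

lemma sum_powers_le_geometric:
  fixes q :: real
  assumes "finite D" and "0 \<le> q" and "q < 1"
  shows "(\<Sum>k\<in>D. q ^ k) \<le> 1 / (1 - q)"
proof -
  have "(\<Sum>k\<in>D. q ^ k) \<le> (\<Sum>k. q ^ k)"
    using assms by (intro sum_le_suminf summable_geometric) auto
  also have "\<dots> = 1 / (1 - q)"
    using assms by (intro suminf_geometric) auto
  finally show ?thesis .
qed

text \<open>
  The domination hypothesis bounds the weight of a fibre by \<open>r\<^sup>k v\<^sub>\<lambda>\<close> without reference to the defect of
  \<open>\<lambda>\<close>; the comparison of defects is what turns this into a multiple of the term
  \<open>v\<^sub>\<lambda> M\<^bsup>-j(\<lambda>)\<^esup>\<close>. That comparison constrains \<open>j(\<lambda>)\<close> only if the fibre is nonempty,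
  which is why empty fibres are a separate case.
\<close>

lemma defect_coeff_le_of_map:
  fixes S :: "nat \<Rightarrow> 'a set" and T :: "nat \<Rightarrow> 'b set" and f :: "'a \<Rightarrow> 'b"
  assumes fin: "finite (S p)" "finite (T p)"
    and v: "\<And>l. l \<in> T p \<Longrightarrow> v p l \<ge> 0"
    and maps: "\<And>s. s \<in> S p \<Longrightarrow> f s \<in> T p"
    and defect: "\<And>s. s \<in> S p \<Longrightarrow> real (j p (f s)) \<le> \<kappa> * real (d p s)"
    and fibre: "\<And>l. l \<in> T p \<Longrightarrow> (\<Sum>s\<in>{s \<in> S p. f s = l \<and> d p s = k}. w p s) \<le> r ^ k * v p l"
    and "r \<ge> 0" and M: "M \<ge> 1"
  shows "defect_coeff S w d p k \<le> r ^ k * M powr (\<kappa> * real k) * defect_expansion T v j p M"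
proof -
  have term_bound: "(\<Sum>s\<in>{s \<in> S p. f s = l \<and> d p s = k}. w p s)
      \<le> r ^ k * M powr (\<kappa> * real k) * (v p l * M powi (- int (j p l)))" if l: "l \<in> T p" for l
  proof (cases "{s \<in> S p. f s = l \<and> d p s = k} = {}")
    case True
    have "0 \<le> r ^ k * M powr (\<kappa> * real k) * (v p l * M powi (- int (j p l)))"
      using v[OF l] \<open>r \<ge> 0\<close> M by simp
    with True show ?thesis by (simp only: sum.empty)
  next
    case False
    then have "real (j p l) \<le> \<kappa> * real k" using defect by auto
    then have "M powr real (j p l) \<le> M powr (\<kappa> * real k)" using M by (intro powr_mono) auto
    then have "1 \<le> M powr (\<kappa> * real k) * M powi (- int (j p l))"
      using M by (simp add: powr_realpow power_int_minus field_simps)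
    then have "r ^ k * v p l * 1
        \<le> r ^ k * v p l * (M powr (\<kappa> * real k) * M powi (- int (j p l)))"
      using v[OF l] \<open>r \<ge> 0\<close> by (intro mult_left_mono) auto
    with fibre[OF l] show ?thesis by (simp add: mult_ac)
  qed
  have "defect_coeff S w d p k
      = (\<Sum>l\<in>T p. \<Sum>s\<in>{s \<in> {s \<in> S p. d p s = k}. f s = l}. w p s)"
    unfolding defect_coeff_def using fin maps by (intro sum.group[symmetric]) auto
  also have "\<dots> = (\<Sum>l\<in>T p. \<Sum>s\<in>{s \<in> S p. f s = l \<and> d p s = k}. w p s)"
    by (intro sum.cong refl) auto
  also have "\<dots> \<le> (\<Sum>l\<in>T p. r ^ k * M powr (\<kappa> * real k) * (v p l * M powi (- int (j p l))))"
    by (intro sum_mono term_bound)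
  finally show ?thesis by (simp add: defect_expansion_def sum_distrib_left)
qed

text \<open>
  Geometric growth of the coefficients is all that the bound on the expansion needs; here \<open>c\<close>
  stands for \<open>r M\<^bsup>\<kappa>\<^esup>\<close> and \<open>F\<close> for the target expansion.
\<close>

lemma defect_expansion_le_of_coeff_le:
  assumes fin: "finite (S p)"
    and coeff: "\<And>k. defect_coeff S w d p k \<le> c ^ k * F"
    and "0 \<le> c" and "c < x" and "0 \<le> F"
  shows "defect_expansion S w d p x \<le> F / (1 - c / x)"
proof -
  have "defect_expansion S w d p x = (\<Sum>k\<in>d p ` S p. defect_coeff S w d p k / x ^ k)"
    by (rule defect_expansion_eq_sum_defect_coeff[of S, OF fin])
  also have "\<dots> \<le> (\<Sum>k\<in>d p ` S p. c ^ k * F / x ^ k)"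
    using assms by (intro sum_mono divide_right_mono) auto
  also have "\<dots> = F * (\<Sum>k\<in>d p ` S p. (c / x) ^ k)"
    by (simp add: sum_distrib_left power_divide mult_ac)
  also have "\<dots> \<le> F * (1 / (1 - c / x))"
    using assms by (intro mult_left_mono sum_powers_le_geometric) auto
  finally show ?thesis by simp
qed

theorem theorem10p4:
  fixes \<Omega> :: "nat \<Rightarrow> 'a set" and \<Lambda> :: "nat \<Rightarrow> 'b set"
    and w :: "nat \<Rightarrow> 'a \<Rightarrow> real" and v :: "nat \<Rightarrow> 'b \<Rightarrow> real"
    and \<delta> :: "nat \<Rightarrow> 'a \<Rightarrow> nat" and j :: "nat \<Rightarrow> 'b \<Rightarrow> nat"
    and \<kappa> :: real and r :: "nat \<Rightarrow> real" and \<phi> :: "nat \<Rightarrow> 'a \<Rightarrow> 'b"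
  assumes "\<And>p. p \<ge> 2 \<Longrightarrow> finite (\<Omega> p)"
    and "\<And>p. p \<ge> 2 \<Longrightarrow> finite (\<Lambda> p)"
    and "\<And>p \<omega>. p \<ge> 2 \<Longrightarrow> \<omega> \<in> \<Omega> p \<Longrightarrow> w p \<omega> \<ge> 0"
    and "\<And>p l. p \<ge> 2 \<Longrightarrow> l \<in> \<Lambda> p \<Longrightarrow> v p l \<ge> 0"
    and "\<kappa> \<ge> 0"
    and "\<And>p. p \<ge> 2 \<Longrightarrow> r p \<ge> 1"
    and "\<And>p \<omega>. p \<ge> 2 \<Longrightarrow> \<omega> \<in> \<Omega> p \<Longrightarrow> \<phi> p \<omega> \<in> \<Lambda> p"
    and "\<And>p \<omega>. p \<ge> 2 \<Longrightarrow> \<omega> \<in> \<Omega> p \<Longrightarrow> real (j p (\<phi> p \<omega>)) \<le> \<kappa> * real (\<delta> p \<omega>)"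
    and "\<And>p l d. p \<ge> 2 \<Longrightarrow> l \<in> \<Lambda> p \<Longrightarrow>
           (\<Sum>\<omega>\<in>{\<omega> \<in> \<Omega> p. \<phi> p \<omega> = l \<and> \<delta> p \<omega> = d}. w p \<omega>) \<le> r p ^ d * v p l"
  shows "\<forall>p\<ge>2.
      (\<forall>M N. M \<ge> 1 \<and> N > r p * M powr \<kappa> \<longrightarrow>
         defect_expansion \<Omega> w \<delta> p N
           \<le> defect_expansion \<Lambda> v j p M / (1 - r p * M powr \<kappa> / N)) \<and>
      (\<forall>M d. M \<ge> 1 \<longrightarrow>
         defect_coeff \<Omega> w \<delta> p d
           \<le> r p ^ d * M powr (\<kappa> * real d) * defect_expansion \<Lambda> v j p M)"
proof (intro allI impI)
  fix p :: nat
  assume p: "p \<ge> 2"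
  have coeff: "defect_coeff \<Omega> w \<delta> p d
      \<le> r p ^ d * M powr (\<kappa> * real d) * defect_expansion \<Lambda> v j p M" if "M \<ge> 1" for M d
    using assms(1,2,4,6-9)[OF p] that
    by (intro defect_coeff_le_of_map[where f = "\<phi> p"]) (auto intro: order_trans[OF zero_le_one])
  have expansion: "defect_expansion \<Omega> w \<delta> p N
      \<le> defect_expansion \<Lambda> v j p M / (1 - r p * M powr \<kappa> / N)"
    if M: "M \<ge> 1" and N: "N > r p * M powr \<kappa>" for M N
  proof (rule defect_expansion_le_of_coeff_le)
    show "finite (\<Omega> p)" using assms(1)[OF p] .
    show "defect_coeff \<Omega> w \<delta> p k \<le> (r p * M powr \<kappa>) ^ k * defect_expansion \<Lambda> v j p M" for k
      using coeff[OF M, of k] M by (simp add: power_mult_distrib powr_power mult.commute)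
    show "0 \<le> r p * M powr \<kappa>" using assms(6)[OF p] by simp
    show "r p * M powr \<kappa> < N" using N .
    show "0 \<le> defect_expansion \<Lambda> v j p M"
      using assms(4)[OF p] M by (intro defect_expansion_nonneg) auto
  qed
  show "(\<forall>M N. M \<ge> 1 \<and> N > r p * M powr \<kappa> \<longrightarrow>
         defect_expansion \<Omega> w \<delta> p N
           \<le> defect_expansion \<Lambda> v j p M / (1 - r p * M powr \<kappa> / N)) \<and>
      (\<forall>M d. M \<ge> 1 \<longrightarrow>
         defect_coeff \<Omega> w \<delta> p d
           \<le> r p ^ d * M powr (\<kappa> * real d) * defect_expansion \<Lambda> v j p M)"
    using coeff expansion by blast
qed

end
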